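(* Let $n\ge 2$ be an integer and $\lambda\in(0,1]$. For $r\in(0,1]$ let $F_{\lambda,r}$ be the rescaled Pareto distribution with support $[1,\infty)$ and cdf $$F_{\lambda,r}(x)=1-\frac{1}{\left[1+\frac1r(x-1)\right]^{1/\lambda}}.$$ Let $\beta_{n,\lambda}=\frac{n!\,\Gamma(2-\lambda)}{\Gamma(n+1-\lambda)}$ and $$H_{n,\lambda}(r,q)=\left(1+r\left(\frac1{q^\lambda}-1\right)\right)\left(1-(1-q)^n\right),\qquad r,q\in[0,1],$$ extended continuously to $q=0$. Then for every $r\in(0,1]$, $$\mathrm{APX}(F_{\lambda,r},n)\ge\frac{1+r(\beta_{n,\lambda}-1)}{\sup_{q\in[0,1]}H_{n,\lambda}(r,q)}.$$ Consequently, the worst-case approximation ratio over $\lambda$-regular distributions satisfies $$\mathrm{APX}(n,\lambda)\ge\sup_{r\in[0,1]}\inf_{q\in[0,1]}\frac{1+r(\beta_{n,\lambda}-1)}{H_{n,\lambda}(r,q)}.$$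
   Context: $F$ denotes the cdf of a continuous (absolutely continuous) probability distribution with pdf $f$, supported on an interval $D_F\subseteq[0,\infty)$. For $\lambda\in(0,1]$, $F$ is $\lambda$-regular if $\phi_\lambda(x)=\lambda x-\frac{1-F(x)}{f(x)}$ is nondecreasing on $D_F$; equivalently $(1-F(x))^{-\lambda}$ is convex. $\mathcal D_\lambda$ is the family of all $\lambda$-regular distributions. For $n\ge2$ bidders with i.i.d. valuations from $F$, let $X_{1:n}\le\dots\le X_{n:n}$ be the order statistics of $n$ i.i.d. draws. $\mathrm{Myerson}(F,n)$ denotes the maximum expected revenue achievable by any (truthful) auction; by Myerson's theorem, for these distributions it equals the best expected revenue of a second-price auction with reserve, $\mathrm{Myerson}(F,n)=\sup_{p\ge0}\mathbb{E}\left[\max\{p,X_{n-1:n}\}\mathbf 1\{X_{n:n}\ge p\}\right]$. The optimal anonymous pricing revenue is $\mathrm{Price}(F,n)=\sup_{p\in D_F}p\,(1-F(p)^n)$; $\mathrm{APX}(F,n)=\mathrm{Myerson}(F,n)/\mathrm{Price}(F,n)$ and $\mathrm{APX}(n,\lambda)=\sup_{F\in\mathcal D_\lambda}\mathrm{APX}(F,n)$. The value $H_{n,\lambda}(r,0)$ is the limit as $q\to0^+$. Where $H_{n,\lambda}(r,q)=0$ (this happens only for $q=0$) the quotient in the infimum is read as $+\infty$. $\Gamma$ is the gamma function. *)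

theory Defs
  imports "HOL-Probability.Probability"
begin

text \<open>
  Distributions are represented by their cdf \<open>F\<close>; the associated probability measure on the
  reals is \<^term>\<open>interval_measure F\<close>.
\<close>

definition is_pdf :: "(real \<Rightarrow> real) \<Rightarrow> (real \<Rightarrow> real) \<Rightarrow> bool" where
  "is_pdf F f \<longleftrightarrow>
     (\<forall>x. 0 \<le> f x) \<and> has_bochner_integral lborel f 1 \<and>
     (\<forall>x. F x = (LINT y:{..x}|lborel. f y))"

text \<open>
  The set \<open>D\<^sub>F\<close>, as the (closed) topological support. It is determined by \<open>F\<close>, so that nothing
  below depends on a choice of endpoints.
\<close>

definition val_support :: "(real \<Rightarrow> real) \<Rightarrow> real set" where
  "val_support F = {x. \<forall>e>0. F (x - e) < F (x + e)}"

text \<open>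
  The function \<open>\<phi>\<^sub>\<lambda>\<close> takes extended real values, where \<open>a / 0 = \<infinity>\<close> for \<open>a > 0\<close> and \<open>0 / 0 = 0\<close>.
  Hence \<open>\<phi>\<^sub>\<lambda>\<close> is \<open>-\<infinity>\<close> at the left endpoint of the support if the density vanishes there, and
  \<open>\<lambda>x\<close> at a finite right endpoint \<open>x\<close> (where \<open>F x = 1\<close>): monotonicity on the closed support is thus
  the same condition as monotonicity on its interior.
\<close>

definition virtual_val :: "real \<Rightarrow> (real \<Rightarrow> real) \<Rightarrow> (real \<Rightarrow> real) \<Rightarrow> real \<Rightarrow> ereal" where
  "virtual_val l F f x = ereal (l * x) - ereal (1 - F x) / ereal (f x)"

text \<open>
  Densities are only determined almost everywhere, so regularity asks for some version of the
  density for which \<open>\<phi>\<^sub>\<lambda>\<close> is nondecreasing.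
\<close>

definition regular_family :: "real \<Rightarrow> (real \<Rightarrow> real) set" where
  "regular_family l =
     {F. is_interval (val_support F) \<and> val_support F \<subseteq> {0..} \<and>
         (\<exists>f. is_pdf F f \<and> mono_on (val_support F) (virtual_val l F f))}"

definition valuations :: "(real \<Rightarrow> real) \<Rightarrow> nat \<Rightarrow> (nat \<Rightarrow> real) measure" where
  "valuations F n = Pi\<^sub>M {..<n} (\<lambda>_. interval_measure F)"

definition profiles :: "(real \<Rightarrow> real) \<Rightarrow> nat \<Rightarrow> (nat \<Rightarrow> real) set" where
  "profiles F n = (\<Pi>\<^sub>E i\<in>{..<n}. val_support F)"

text \<open>
  A (possibly randomized) direct auction of a single item: \<open>x i v\<close> is the probability that bidder
  \<open>i\<close> wins and \<open>t i v\<close> the expected payment of bidder \<open>i\<close> at the bid profile \<open>v\<close>. The last two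
  conditions are dominant-strategy incentive compatibility and individual rationality.
\<close>

definition truthful_auction ::
  "(real \<Rightarrow> real) \<Rightarrow> nat \<Rightarrow> (nat \<Rightarrow> (nat \<Rightarrow> real) \<Rightarrow> real) \<Rightarrow> (nat \<Rightarrow> (nat \<Rightarrow> real) \<Rightarrow> real) \<Rightarrow> bool" where
  "truthful_auction F n x t \<longleftrightarrow>
     (\<forall>i<n. x i \<in> borel_measurable (valuations F n) \<and> t i \<in> borel_measurable (valuations F n)) \<and>
     (\<forall>v\<in>profiles F n. (\<forall>i<n. 0 \<le> x i v) \<and> (\<Sum>i<n. x i v) \<le> 1) \<and>
     (\<forall>v\<in>profiles F n. \<forall>i<n. \<forall>b\<in>val_support F.
        v i * x i v - t i v \<ge> v i * x i (v(i := b)) - t i (v(i := b))) \<and>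
     (\<forall>v\<in>profiles F n. \<forall>i<n. v i * x i v - t i v \<ge> 0)"

text \<open>
  Payments may be negative. Integrability only makes the expected revenue meaningful: for
  distributions in \<^term>\<open>regular_family l\<close> with \<open>0 < l \<le> 1\<close>, the positive part of the revenue of a
  truthful auction always has finite expectation, so only auctions with expected revenue \<open>-\<infinity>\<close> are
  excluded.
\<close>

definition myerson :: "(real \<Rightarrow> real) \<Rightarrow> nat \<Rightarrow> ereal" where
  "myerson F n =
     Sup {ereal (LINT v|valuations F n. (\<Sum>i<n. t i v)) | x t.
            truthful_auction F n x t \<and> integrable (valuations F n) (\<lambda>v. \<Sum>i<n. t i v)}"

definition price :: "(real \<Rightarrow> real) \<Rightarrow> nat \<Rightarrow> ereal" where
  "price F n = (SUP p\<in>val_support F. ereal (p * (1 - F p ^ n)))"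

definition apx :: "(real \<Rightarrow> real) \<Rightarrow> nat \<Rightarrow> ereal" where
  "apx F n = myerson F n / price F n"

definition apx_worst :: "nat \<Rightarrow> real \<Rightarrow> ereal" where
  "apx_worst n l = (SUP F\<in>regular_family l. apx F n)"

definition pareto_cdf :: "real \<Rightarrow> real \<Rightarrow> real \<Rightarrow> real" where
  "pareto_cdf l r x = (if x < 1 then 0 else 1 - 1 / (1 + (1 / r) * (x - 1)) powr (1 / l))"

definition beta_const :: "nat \<Rightarrow> real \<Rightarrow> real" where
  "beta_const n l = fact n * Gamma (2 - l) / Gamma (real n + 1 - l)"

definition H_raw :: "nat \<Rightarrow> real \<Rightarrow> real \<Rightarrow> real \<Rightarrow> real" where
  "H_raw n l r q = (1 + r * (1 / q powr l - 1)) * (1 - (1 - q) ^ n)"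

text \<open>
  Note that \<open>0 powr l = 0\<close>, so \<^term>\<open>H_raw n l r 0\<close> is not the continuous extension when \<open>l = 1\<close>.
\<close>

definition H_fun :: "nat \<Rightarrow> real \<Rightarrow> real \<Rightarrow> real \<Rightarrow> real" where
  "H_fun n l r q = (if q = 0 then Lim (at_right 0) (H_raw n l r) else H_raw n l r q)"

end

theory Submission
  imports Defs "HOL-Real_Asymp.Real_Asymp"
begin

text \<open>
  The optimal auction earns at least as much as a second-price auction without reserve, whose
  revenue is the second highest value \<open>S\<close>. If \<open>g u\<close> is the probability that at least two of \<open>n\<close>
  independent uniform variables are below \<open>u\<close>, then \<open>S > x\<close> has probability \<open>g (1 - F x)\<close>, and
  \<open>g' s = n (n - 1) s (1 - s)^(n - 2)\<close>. Writing \<open>g\<close> as the integral of \<open>g'\<close> and exchanging the order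
  of integration turns the integral of the tail probabilities of \<open>S\<close> into the integral over
  \<open>[0, 1]\<close> of \<open>g' s\<close> times the Pareto quantile \<open>1 + r (s^(-\<lambda>) - 1)\<close>, which is a Beta integral.
  An anonymous price that each single bidder accepts with probability \<open>q\<close> earns \<open>H r q\<close>.
  The Pareto distribution is \<open>\<lambda>\<close>-regular because its \<open>\<phi>\<^sub>\<lambda>\<close> is constant. The degenerate case
  \<open>r = 0\<close> of the supremum is the limit \<open>r \<rightarrow> 0\<close>.
\<close>

section \<open>The rescaled Pareto distribution\<close>

text \<open>Clipping \<open>x\<close> at 1 merges the two branches of the cdf into a single formula,
  so monotonicity and continuity at 1 need no case split.\<close>

lemma pareto_cdf_eq:
  assumes "0 < r"
  shows "pareto_cdf l r x = 1 - (1 + (max 1 x - 1) / r) powr (-1 / l)"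
  using assms by (auto simp: pareto_cdf_def powr_minus_divide max_def)

lemma pareto_tail_mono:
  fixes x y l r :: real
  assumes "0 < r" "0 < l" "x \<le> y"
  shows "(1 + (max 1 y - 1) / r) powr (-1 / l) \<le> (1 + (max 1 x - 1) / r) powr (-1 / l)"
proof -
  have "0 < 1 + (max 1 x - 1) / r"
    using assms by (intro add_pos_nonneg divide_nonneg_nonneg) auto
  moreover have "1 + (max 1 x - 1) / r \<le> 1 + (max 1 y - 1) / r"
    using assms by (intro add_left_mono divide_right_mono) auto
  ultimately show ?thesis
    using assms by (intro powr_mono2') auto
qed

lemma pareto_cdf_mono: "0 < r \<Longrightarrow> 0 < l \<Longrightarrow> x \<le> y \<Longrightarrow> pareto_cdf l r x \<le> pareto_cdf l r y"
  using pareto_tail_mono[of r l x y] by (simp add: pareto_cdf_eq)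

lemma isCont_pareto_cdf:
  assumes "0 < r"
  shows "isCont (pareto_cdf l r) x"
proof -
  have "0 < 1 + (max 1 x - 1) / r"
    using assms by (intro add_pos_nonneg divide_nonneg_nonneg) auto
  then have "isCont (\<lambda>x. 1 - (1 + (max 1 x - 1) / r) powr (-1 / l)) x"
    using assms by (auto intro!: continuous_intros)
  then show ?thesis
    using assms by (simp add: pareto_cdf_eq[OF assms, abs_def])
qed

lemma pareto_tail_tendsto:
  fixes r l :: real
  assumes "0 < r" "0 < l"
  shows "((\<lambda>x. (1 + (x - 1) / r) powr (-1 / l)) \<longlongrightarrow> 0) at_top"
proof (rule tendsto_neg_powr)
  show "-1 / l < 0" using assms by simp
  show "LIM x at_top. 1 + (x - 1) / r :> at_top" using assms by real_asymp
qed

lemma pareto_cdf_at_top: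
  assumes "0 < r" "0 < l"
  shows "(pareto_cdf l r \<longlongrightarrow> 1) at_top"
proof -
  have "((\<lambda>x. 1 - (1 + (x - 1) / r) powr (-1 / l)) \<longlongrightarrow> 1 - 0) at_top"
    by (intro tendsto_diff tendsto_const pareto_tail_tendsto assms)
  moreover have "\<forall>\<^sub>F x in at_top. 1 - (1 + (x - 1) / r) powr (-1 / l) = pareto_cdf l r x"
    using eventually_ge_at_top[of 1] by eventually_elim (simp add: assms pareto_cdf_eq)
  ultimately show ?thesis
    using tendsto_cong by fastforce
qed

lemma pareto_cdf_at_bot: "(pareto_cdf l r \<longlongrightarrow> 0) at_bot"
  by (rule tendsto_eventually) (auto simp: pareto_cdf_def eventually_at_bot_dense intro!: exI[of _ 1])

lemma real_distribution_pareto: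
  assumes "0 < r" "0 < l"
  shows "real_distribution (interval_measure (pareto_cdf l r))"
  by (rule real_distribution_interval_measure)
    (use assms in \<open>auto simp: pareto_cdf_mono pareto_cdf_at_top pareto_cdf_at_bot
      isCont_pareto_cdf continuous_at_imp_continuous_at_within\<close>)

lemma cdf_pareto:
  assumes "0 < r" "0 < l"
  shows "cdf (interval_measure (pareto_cdf l r)) = pareto_cdf l r"
  by (rule cdf_interval_measure)
    (use assms in \<open>auto simp: pareto_cdf_mono pareto_cdf_at_bot
      isCont_pareto_cdf continuous_at_imp_continuous_at_within\<close>)

lemma val_support_pareto:
  assumes "0 < r" "0 < l"
  shows "val_support (pareto_cdf l r) = {1..}"
proof (intro set_eqI iffI)
  fix x assume "x \<in> val_support (pareto_cdf l r)"
  then have *: "pareto_cdf l r (x - e) < pareto_cdf l r (x + e)" if "e > 0" for e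
    using that by (auto simp: val_support_def)
  show "x \<in> {1..}"
  proof (rule ccontr)
    assume "x \<notin> {1..}"
    \<comment> \<open>With half the distance to 1 as radius, both points stay left of 1, where the
      cdf vanishes.\<close>
    with *[of "(1 - x) / 2"] show False by (auto simp: pareto_cdf_def field_simps)
  qed
next
  fix x :: real assume x: "x \<in> {1..}"
  have "pareto_cdf l r (x - e) < pareto_cdf l r (x + e)" if "e > 0" for e
  proof -
    have "pareto_cdf l r (x - e) \<le> pareto_cdf l r x"
      using assms that by (intro pareto_cdf_mono) auto
    also have "\<dots> < pareto_cdf l r (x + e)"
      using assms that x
      by (auto simp: pareto_cdf_eq max_def divide_simps
          intro!: powr_less_mono2_neg add_pos_nonneg divide_strict_right_mono)
    finally show ?thesis .
  qed
  then show "x \<in> val_support (pareto_cdf l r)" by (auto simp: val_support_def)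
qed

section \<open>Density and regularity\<close>

definition pareto_pdf :: "real \<Rightarrow> real \<Rightarrow> real \<Rightarrow> real" where
  "pareto_pdf l r x = (if x < 1 then 0 else (1 + (x - 1) / r) powr (-1 / l - 1) / (l * r))"

lemma pareto_cdf_deriv:
  assumes "0 < r" "0 < l" "1 \<le> x"
  shows "((\<lambda>x. 1 - (1 + (x - 1) / r) powr (-1 / l)) has_real_derivative pareto_pdf l r x) (at x)"
proof -
  have "0 < 1 + (x - 1) / r"
    using assms by (intro add_pos_nonneg divide_nonneg_nonneg) auto
  then show ?thesis
    using assms by (auto intro!: derivative_eq_intros simp: pareto_pdf_def)
qed

lemma borel_measurable_pareto_pdf [measurable]: "pareto_pdf l r \<in> borel_measurable borel"
  unfolding pareto_pdf_def[abs_def] by measurable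

lemma pareto_pdf_nonneg: "0 < r \<Longrightarrow> 0 < l \<Longrightarrow> 0 \<le> pareto_pdf l r x"
  by (simp add: pareto_pdf_def)

lemma is_pdf_pareto:
  assumes "0 < r" "0 < l"
  shows "is_pdf (pareto_cdf l r) (pareto_pdf l r)"
proof -
  have "(\<integral>\<^sup>+x. ennreal (pareto_pdf l r x) * indicator {1..} x \<partial>lborel)
      = ennreal (1 - (1 - (1 + (1 - 1) / r) powr (-1 / l)))"
    using assms
    by (intro nn_integral_FTC_atLeast pareto_cdf_deriv pareto_pdf_nonneg
        tendsto_diff[of _ 1 _ _ 0, simplified] pareto_tail_tendsto) auto
  moreover have "(\<integral>\<^sup>+x. ennreal (pareto_pdf l r x) * indicator {1..} x \<partial>lborel)
      = (\<integral>\<^sup>+x. ennreal (pareto_pdf l r x) \<partial>lborel)"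
    by (intro nn_integral_cong) (auto simp: pareto_pdf_def indicator_def)
  ultimately have "has_bochner_integral lborel (pareto_pdf l r) 1"
    using assms
    by (intro has_bochner_integral_nn_integral) (auto simp: pareto_pdf_nonneg)
  moreover have "pareto_cdf l r x = (LINT y:{..x}|lborel. pareto_pdf l r y)" for x
  proof (cases "x < 1")
    case True
    then have "indicator {..x} y *\<^sub>R pareto_pdf l r y = 0" for y
      by (auto simp: pareto_pdf_def indicator_def)
    then have "(LINT y:{..x}|lborel. pareto_pdf l r y) = 0"
      unfolding set_lebesgue_integral_def by (simp only: integral_zero)
    with True show ?thesis by (simp add: pareto_cdf_def)
  next
    case False
    have "indicator {..x} y *\<^sub>R pareto_pdf l r y = pareto_pdf l r y * indicator {1..x} y" for y
      by (auto simp: pareto_pdf_def indicator_def)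
    then have "(LINT y:{..x}|lborel. pareto_pdf l r y)
        = (LINT y|lborel. pareto_pdf l r y * indicator {1..x} y)"
      unfolding set_lebesgue_integral_def by (simp only:)
    also have "\<dots> = (1 - (1 + (x - 1) / r) powr (-1 / l)) - (1 - (1 + (1 - 1) / r) powr (-1 / l))"
      using assms False
      by (intro integral_FTC_Icc_nonneg pareto_cdf_deriv pareto_pdf_nonneg) auto
    finally show ?thesis using False assms by (simp add: pareto_cdf_eq)
  qed
  ultimately show ?thesis
    using assms by (auto simp: is_pdf_def pareto_pdf_nonneg)
qed

text \<open>With \<open>y = 1 + (x - 1) / r\<close>, the tail divided by the density is
  \<open>l * r * y\<close>. This is affine in \<open>x\<close> with slope \<open>l\<close>, so it
  cancels the growth of \<open>l * x\<close> exactly: these distributions lie on the boundary of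
  regularity.\<close>

lemma virtual_val_pareto:
  assumes "0 < r" "0 < l" "1 \<le> x"
  shows "virtual_val l (pareto_cdf l r) (pareto_pdf l r) x = ereal (l * (1 - r))"
proof -
  define y where "y = 1 + (x - 1) / r"
  have y: "0 < y"
    using assms unfolding y_def by (intro add_pos_nonneg divide_nonneg_nonneg) auto
  have f: "pareto_pdf l r x = y powr (-1 / l) / (y * l * r)"
    using assms y by (simp add: pareto_pdf_def y_def[symmetric] powr_diff)
  have F: "1 - pareto_cdf l r x = y powr (-1 / l)"
    using assms by (simp add: pareto_cdf_eq y_def)
  have "l * x - y * l * r = l * (1 - r)"
    using assms by (simp add: y_def field_simps)
  then show ?thesis
    using assms y unfolding virtual_val_def F f by auto
qed

lemma pareto_regular:
  assumes "0 < r" "0 < l"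
  shows "pareto_cdf l r \<in> regular_family l"
  using assms is_pdf_pareto[OF assms]
  by (auto simp: regular_family_def val_support_pareto virtual_val_pareto mono_on_def is_interval_ci
      intro!: exI[of _ "pareto_pdf l r"])

section \<open>The second-price auction\<close>

text \<open>Ties go to the lowest index, so that a nonempty set of bidders has exactly one
  winner.\<close>

definition wins :: "nat \<Rightarrow> nat \<Rightarrow> (nat \<Rightarrow> real) \<Rightarrow> bool" where
  "wins n i v \<longleftrightarrow> (\<forall>j<n. if j < i then v j < v i else v j \<le> v i)"

text \<open>Including \<open>0\<close> does not matter for nonnegative values; it makes the revenue nonnegative everywhere.\<close>

definition threshold :: "nat \<Rightarrow> nat \<Rightarrow> (nat \<Rightarrow> real) \<Rightarrow> real" where
  "threshold n i v = Max (insert 0 (v ` ({..<n} - {i})))"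

definition spa_alloc :: "nat \<Rightarrow> nat \<Rightarrow> (nat \<Rightarrow> real) \<Rightarrow> real" where
  "spa_alloc n i v = (if wins n i v then 1 else 0)"

definition spa_pay :: "nat \<Rightarrow> nat \<Rightarrow> (nat \<Rightarrow> real) \<Rightarrow> real" where
  "spa_pay n i v = (if wins n i v then threshold n i v else 0)"

lemma threshold_nonneg: "0 \<le> threshold n i v"
  by (simp add: threshold_def)

lemma threshold_le_iff: "threshold n i v \<le> x \<longleftrightarrow> 0 \<le> x \<and> (\<forall>j<n. j \<noteq> i \<longrightarrow> v j \<le> x)"
  by (auto simp: threshold_def)

lemma threshold_upd [simp]: "threshold n i (v(i := b)) = threshold n i v"
proof -
  have "v(i := b) ` ({..<n} - {i}) = v ` ({..<n} - {i})" by auto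
  then show ?thesis by (simp only: threshold_def)
qed

lemma wins_unique:
  assumes "wins n i v" "wins n j v" "i < n" "j < n"
  shows "i = j"
proof (rule ccontr)
  assume "i \<noteq> j"
  then consider "i < j" | "j < i" by linarith
  then show False
  proof cases
    case 1
    with assms have "v i < v j" "v j \<le> v i"
      by (auto simp: wins_def dest!: spec[of _ i] spec[of _ j])
    then show False by simp
  next
    case 2
    with assms have "v j < v i" "v i \<le> v j"
      by (auto simp: wins_def dest!: spec[of _ i] spec[of _ j])
    then show False by simp
  qed
qed

lemma wins_exists:
  assumes "0 < n"
  shows "\<exists>i<n. wins n i v"
proof -
  have "Max (v ` {..<n}) \<in> v ` {..<n}"
    using assms by (intro Max_in) auto
  then obtain k where k: "k < n" "v k = Max (v ` {..<n})" by auto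
  \<comment> \<open>By the tie-breaking rule the winner is the least index at which the maximum is
    attained.\<close>
  define w where "w = (LEAST i. i < n \<and> v i = Max (v ` {..<n}))"
  have w: "w < n \<and> v w = Max (v ` {..<n})"
    unfolding w_def by (rule LeastI[of _ k]) (use k in auto)
  have le: "v j \<le> v w" if "j < n" for j
    using w that by auto
  moreover have "v j < v w" if "j < w" for j
  proof -
    have "v j \<noteq> v w"
      using not_less_Least[of j "\<lambda>i. i < n \<and> v i = Max (v ` {..<n})", folded w_def] that w
      by auto
    moreover have "v j \<le> v w" using le that w by simp
    ultimately show ?thesis by linarith
  qed
  ultimately show ?thesis
    using w by (auto simp: wins_def)
qed

lemma sum_spa_pay:
  assumes "wins n w v" "w < n"
  shows "(\<Sum>i<n. spa_pay n i v) = threshold n w v"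
proof -
  have "(\<Sum>i<n. spa_pay n i v) = (\<Sum>i<n. if i = w then threshold n w v else 0)"
    using assms wins_unique by (intro sum.cong) (auto simp: spa_pay_def)
  then show ?thesis using assms by simp
qed

lemma sum_spa_alloc_le: "(\<Sum>i<n. spa_alloc n i v) \<le> 1"
proof (cases "n = 0")
  case False
  then obtain w where w: "w < n" "wins n w v" using wins_exists by blast
  have "(\<Sum>i<n. spa_alloc n i v) = (\<Sum>i<n. if i = w then 1 else 0)"
    using w wins_unique by (intro sum.cong) (auto simp: spa_alloc_def)
  then show ?thesis using w by simp
qed simp

text \<open>The revenue is the threshold of the winner, so it exceeds \<open>x\<close> iff some
  other bidder does, and then the winner does as well. Conversely, of two distinct bidders above
  \<open>x\<close> at least one is not the winner. The 0 inside the threshold is harmless because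
  \<open>x\<close> is nonnegative.\<close>

lemma spa_revenue_gt_iff:
  assumes "0 < n" "0 \<le> x"
  shows "x < (\<Sum>i<n. spa_pay n i v) \<longleftrightarrow> (\<exists>i<n. \<exists>j<n. i \<noteq> j \<and> x < v i \<and> x < v j)"
proof -
  obtain w where w: "w < n" "wins n w v" using wins_exists assms by blast
  then have le: "v j \<le> v w" if "j < n" for j
    using that by (auto simp: wins_def not_less split: if_splits) (metis less_imp_le not_less)
  have "x < (\<Sum>i<n. spa_pay n i v) \<longleftrightarrow> (\<exists>j<n. j \<noteq> w \<and> x < v j)"
    using assms w threshold_le_iff[of n w v x] by (auto simp: sum_spa_pay not_le[symmetric])
  also have "\<dots> \<longleftrightarrow> (\<exists>i<n. \<exists>j<n. i \<noteq> j \<and> x < v i \<and> x < v j)"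
    using le w by (metis less_le_trans)
  finally show ?thesis .
qed

section \<open>Measurability and truthfulness\<close>

lemma measurable_valuation [measurable]:
  assumes "i < n"
  shows "(\<lambda>v. v i) \<in> borel_measurable (valuations F n)"
proof -
  have "(\<lambda>v. v i) \<in> valuations F n \<rightarrow>\<^sub>M interval_measure F"
    unfolding valuations_def using assms by (intro measurable_component_singleton) auto
  then show ?thesis by (simp cong: measurable_cong_sets)
qed

lemma measurable_wins [measurable]:
  assumes [measurable]: "i < n"
  shows "Measurable.pred (valuations F n) (wins n i)"
proof -
  have "Measurable.pred (valuations F n) (\<lambda>v. \<forall>j\<in>{..<n}. if j < i then v j < v i else v j \<le> v i)"
  proof (rule pred_intros_finite)
    fix j assume j: "j \<in> {..<n}"
    then have [measurable]: "j < n" by simp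
    show "Measurable.pred (valuations F n) (\<lambda>v. if j < i then v j < v i else v j \<le> v i)"
      using assms j
      by (cases "j < i")
        (auto intro!: borel_measurable_less borel_measurable_le measurable_valuation simp: pred_def)
  qed simp
  moreover have "wins n i = (\<lambda>v. \<forall>j\<in>{..<n}. if j < i then v j < v i else v j \<le> v i)"
    by (auto simp: wins_def fun_eq_iff)
  ultimately show ?thesis by simp
qed

lemma measurable_threshold [measurable]: "threshold n i \<in> borel_measurable (valuations F n)"
proof (cases "{..<n} - {i} = {}")
  case True
  have "threshold n i = (\<lambda>v. 0)"
    unfolding threshold_def fun_eq_iff True by simp
  then show ?thesis by simp
next
  case False
  \<comment> \<open>Splitting the 0 off as a binary maximum is sound only over a nonempty set, hence
    the case distinction.\<close>
  then have "threshold n i = (\<lambda>v. max 0 (Max ((\<lambda>j. v j) ` ({..<n} - {i}))))"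
    by (simp add: threshold_def fun_eq_iff del: Diff_eq_empty_iff)
  moreover have "(\<lambda>v. max 0 (Max ((\<lambda>j. v j) ` ({..<n} - {i})))) \<in> borel_measurable (valuations F n)"
    by (intro borel_measurable_max borel_measurable_Max) auto
  ultimately show ?thesis by simp
qed

lemma measurable_spa_pay [measurable]: "i < n \<Longrightarrow> spa_pay n i \<in> borel_measurable (valuations F n)"
  unfolding spa_pay_def[abs_def] by measurable

lemma measurable_spa_alloc [measurable]:
  "i < n \<Longrightarrow> spa_alloc n i \<in> borel_measurable (valuations F n)"
  unfolding spa_alloc_def[abs_def] by measurable

text \<open>A bidder's threshold does not depend on that bidder's own bid. Every bid therefore
  yields utility 0 or value minus threshold, and the truthful bid attains the larger of the
  two.\<close>

lemma truthful_spa: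
  assumes "val_support F \<subseteq> {0..}"
  shows "truthful_auction F n (spa_alloc n) (spa_pay n)"
proof -
  have val: "v i * spa_alloc n i v - spa_pay n i v = max 0 (v i - threshold n i v)"
    if "v \<in> profiles F n" "i < n" for v i
  proof -
    \<comment> \<open>The threshold is at least 0, so a winner's value can reach it only if it is
      nonnegative.\<close>
    have "0 \<le> v i"
      using that assms by (auto simp: profiles_def PiE_def Pi_def)
    show ?thesis
    proof (cases "wins n i v")
      case True
      then have "v j \<le> v i" if "j < n" for j
        using that by (auto simp: wins_def not_less split: if_splits) (metis less_imp_le not_less)
      then have "threshold n i v \<le> v i"
        using \<open>0 \<le> v i\<close> by (simp add: threshold_le_iff)
      with True show ?thesis by (simp add: spa_alloc_def spa_pay_def)
    next
      case False
      then obtain j where j: "j < n" "j \<noteq> i" "v i \<le> v j"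
        unfolding wins_def by (metis linorder_not_less nle_le)
      have "v j \<le> threshold n i v"
        using j threshold_le_iff[of n i v "threshold n i v"] by auto
      with False j show ?thesis by (simp add: spa_alloc_def spa_pay_def)
    qed
  qed
  moreover have "v i * spa_alloc n i (v(i := b)) - spa_pay n i (v(i := b)) \<le> max 0 (v i - threshold n i v)"
    for v i b
    by (auto simp: spa_alloc_def spa_pay_def)
  ultimately show ?thesis
    using sum_spa_alloc_le by (auto simp: truthful_auction_def) (simp add: spa_alloc_def)
qed

text \<open>The probability that at least two of \<open>n\<close> independent events of probability
  \<open>u\<close> occur: the subtracted terms stand for none and for exactly one.\<close>

definition second_tail :: "nat \<Rightarrow> real \<Rightarrow> real" where
  "second_tail n u = 1 - (1 - u) ^ n - real n * u * (1 - u) ^ (n - 1)"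

lemma emeasure_second_gt:
  assumes "real_distribution (interval_measure F)" "cdf (interval_measure F) = F"
  shows "emeasure (valuations F n)
      {v \<in> space (valuations F n). \<exists>i<n. \<exists>j<n. i \<noteq> j \<and> x < v i \<and> x < v j}
    = ennreal (second_tail n (1 - F x))"
proof -
  let ?M = "interval_measure F"
  interpret M: real_distribution ?M by fact
  interpret product_prob_space "\<lambda>_::nat. ?M" "{..<n}" by standard
  interpret P: finite_product_prob_space "\<lambda>_. ?M" "{..<n}" by standard auto
  \<comment> \<open>The complement of the event splits into disjoint product sets: in
    \<open>A\<close> nobody is above \<open>x\<close>, in \<open>B i\<close> only bidder
    \<open>i\<close> is.\<close>
  define A where "A = (\<Pi>\<^sub>E j\<in>{..<n}. {..x})"
  define B where "B i = (\<Pi>\<^sub>E j\<in>{..<n}. if j = i then {x<..} else {..x})" for i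
  have inA: "v k \<in> {..x}" if "v \<in> A" "k < n" for v k
    using that by (auto simp: A_def)
  have inB: "v k \<in> (if k = i then {x<..} else {..x})" if "v \<in> B i" "k < n" for v i k
    using PiE_mem[OF that(1)[unfolded B_def], of k] that(2) by simp
  have F: "measure ?M {..x} = F x"
    using assms(2) by (simp add: cdf_def fun_eq_iff)
  have F': "measure ?M {x<..} = 1 - F x"
  proof -
    have "{x<..} = space ?M - {..x}" by auto
    then show ?thesis using M.prob_compl[of "{..x}"] F by simp
  qed
  have A: "A \<in> P.events" "P.prob A = F x ^ n"
    unfolding A_def by (auto simp: P.prob_times F intro!: sets_PiM_I_finite)
  have B: "B i \<in> P.events" "P.prob (B i) = (1 - F x) * F x ^ (n - 1)" if "i < n" for i
  proof -
    show "B i \<in> P.events"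
      unfolding B_def by (auto intro!: sets_PiM_I_finite)
    have "P.prob (B i) = (\<Prod>j\<in>{..<n}. measure ?M (if j = i then {x<..} else {..x}))"
      unfolding B_def by (rule P.prob_times) auto
    also have "\<dots> = (1 - F x) * (\<Prod>j\<in>{..<n} - {i}. F x)"
      using that by (subst prod.remove[of _ i]) (auto simp: F F' intro!: prod.cong)
    finally show "P.prob (B i) = (1 - F x) * F x ^ (n - 1)"
      using that by simp
  qed
  have disjB: "disjoint_family_on B {..<n}"
  proof -
    have "i = j" if "v \<in> B i" "v \<in> B j" "i < n" "j < n" for i j v
      using inB[OF that(1) that(3)] inB[OF that(2) that(3)] by (auto split: if_splits)
    then show ?thesis by (auto simp: disjoint_family_on_def)
  qed
  have disjA: "A \<inter> (\<Union>i<n. B i) = {}"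
  proof -
    have False if "v \<in> A" "v \<in> B i" "i < n" for v i
      using inA[OF that(1) that(3)] inB[OF that(2) that(3)] by auto
    then show ?thesis by auto
  qed
  have UB: "(\<Union>i<n. B i) \<in> P.events" using B by auto
  have "P.prob (\<Union>i<n. B i) = (\<Sum>i<n. P.prob (B i))"
    using B disjB by (intro P.finite_measure_finite_Union) auto
  then have "P.prob (A \<union> (\<Union>i<n. B i)) = F x ^ n + real n * ((1 - F x) * F x ^ (n - 1))"
    using A UB disjA B by (subst P.finite_measure_Union) auto
  moreover have "{v \<in> space (valuations F n). \<exists>i<n. \<exists>j<n. i \<noteq> j \<and> x < v i \<and> x < v j}
      = space (Pi\<^sub>M {..<n} (\<lambda>_. ?M)) - (A \<union> (\<Union>i<n. B i))" (is "?S = ?T")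
  proof (intro set_eqI iffI)
    fix v assume "v \<in> ?S"
    then obtain i j where ij: "i < n" "j < n" "i \<noteq> j" "x < v i" "x < v j"
      and sp: "v \<in> space (valuations F n)" by auto
    have "v \<notin> A"
      using inA[of v i] ij by auto
    moreover have "v \<notin> B k" for k
      using inB[of v k i] inB[of v k j] ij by (auto split: if_splits)
    ultimately show "v \<in> ?T" using sp by (auto simp: valuations_def)
  next
    fix v assume v: "v \<in> ?T"
    \<comment> \<open>Since \<open>v\<close> is extensional, it can miss one of the product sets
      only through a coordinate below \<open>n\<close>.\<close>
    then have ext: "v \<in> extensional {..<n}" by (auto simp: space_PiM PiE_def)
    have "v \<notin> A" using v by auto
    then obtain i where i: "i < n" "x < v i"
      using ext by (auto simp: A_def PiE_def Pi_def not_le)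
    have "v \<notin> B i" using v i by auto
    then obtain j where "j < n" "v j \<notin> (if j = i then {x<..} else {..x})"
      using ext unfolding B_def PiE_def Pi_def by auto
    then have "j < n" "j \<noteq> i" "x < v j" using i by (auto split: if_splits)
    then show "v \<in> ?S" using i v by (auto simp: valuations_def)
  qed
  ultimately show ?thesis
    using A UB
    by (simp add: valuations_def P.emeasure_eq_measure P.prob_compl second_tail_def sets.Un
        mult.assoc diff_diff_add del: Diff_Un)
qed

text \<open>Layer-cake formula: a nonnegative variable is the length of the interval from 0 to its
  value. Exchanging the integrals turns its expectation into the integral of its tail
  probabilities.\<close>

lemma nn_integral_spa_revenue:
  assumes "real_distribution (interval_measure F)" "cdf (interval_measure F) = F" "0 < n"
  shows "(\<integral>\<^sup>+v. ennreal (\<Sum>i<n. spa_pay n i v) \<partial>valuations F n)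
    = (\<integral>\<^sup>+x. ennreal (second_tail n (1 - F x)) * indicator {0..} x \<partial>lborel)"
proof -
  interpret M: real_distribution "interval_measure F" by fact
  interpret product_prob_space "\<lambda>_::nat. interval_measure F" "{..<n}" by standard
  interpret V: prob_space "valuations F n" unfolding valuations_def by (rule P.prob_space_axioms)
  interpret pair_sigma_finite lborel "valuations F n" ..
  let ?R = "\<lambda>v. \<Sum>i<n. spa_pay n i v"
  have [measurable]: "?R \<in> borel_measurable (valuations F n)" by (intro borel_measurable_sum) auto
  have "(\<integral>\<^sup>+v. ennreal (?R v) \<partial>valuations F n)
      = (\<integral>\<^sup>+v. (\<integral>\<^sup>+x. indicator {x. 0 \<le> x \<and> x < ?R v} x \<partial>lborel) \<partial>valuations F n)"
  proof (intro nn_integral_cong)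
    fix v
    have "0 \<le> ?R v" by (intro sum_nonneg) (simp add: spa_pay_def threshold_nonneg)
    moreover have "{x. 0 \<le> x \<and> x < ?R v} = {0..<?R v}" by auto
    ultimately show "ennreal (?R v) = (\<integral>\<^sup>+x. indicator {x. 0 \<le> x \<and> x < ?R v} x \<partial>lborel)"
      by simp
  qed
  \<comment> \<open>As a conditional, the integrand is visibly measurable in \<open>x\<close> and
    \<open>v\<close> jointly, as the exchange requires.\<close>
  also have "\<dots> = (\<integral>\<^sup>+v. (\<integral>\<^sup>+x. (if 0 \<le> x \<and> x < ?R v then 1 else 0) \<partial>lborel) \<partial>valuations F n)"
    by (intro nn_integral_cong) (auto simp: indicator_def)
  also have "\<dots> = (\<integral>\<^sup>+x. (\<integral>\<^sup>+v. (if 0 \<le> x \<and> x < ?R v then 1 else 0) \<partial>valuations F n) \<partial>lborel)"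
    by (intro Fubini') measurable
  also have "\<dots> = (\<integral>\<^sup>+x. ennreal (second_tail n (1 - F x)) * indicator {0..} x \<partial>lborel)"
  proof (intro nn_integral_cong)
    fix x :: real
    show "(\<integral>\<^sup>+v. (if 0 \<le> x \<and> x < ?R v then 1 else 0) \<partial>valuations F n)
        = ennreal (second_tail n (1 - F x)) * indicator {0..} x"
    proof (cases "0 \<le> x")
      case True
      have "(\<integral>\<^sup>+v. (if 0 \<le> x \<and> x < ?R v then 1 else 0) \<partial>valuations F n)
          = (\<integral>\<^sup>+v. indicator {v \<in> space (valuations F n). x < ?R v} v \<partial>valuations F n)"
        using True by (intro nn_integral_cong) (auto simp: indicator_def)
      also have "\<dots> = emeasure (valuations F n) {v \<in> space (valuations F n). x < ?R v}"
        by (intro nn_integral_indicator) measurable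
      also have "\<dots> = ennreal (second_tail n (1 - F x))"
        using assms True by (simp add: spa_revenue_gt_iff emeasure_second_gt)
      finally show ?thesis using True by simp
    qed simp
  qed
  finally show ?thesis .
qed

section \<open>Expected second-price revenue\<close>

text \<open>The density of the second smallest of \<open>n\<close> independent uniform variables on
  the unit interval.\<close>

definition second_density :: "nat \<Rightarrow> real \<Rightarrow> real" where
  "second_density n s = real n * (real n - 1) * s * (1 - s) ^ (n - 2)"

lemma second_density_nonneg: "2 \<le> n \<Longrightarrow> 0 \<le> s \<Longrightarrow> s \<le> 1 \<Longrightarrow> 0 \<le> second_density n s"
  by (simp add: second_density_def)

lemma borel_measurable_second_density [measurable]: "second_density n \<in> borel_measurable borel"
  unfolding second_density_def[abs_def] by measurable

lemma second_tail_deriv: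
  assumes "2 \<le> n"
  shows "(second_tail n has_real_derivative second_density n u) (at u)"
proof -
  obtain m where n: "n = Suc (Suc m)"
    using assms by (metis add_2_eq_Suc le_Suc_ex)
  show ?thesis
    unfolding second_tail_def[abs_def] second_density_def n
    by (rule derivative_eq_intros refl)+ (simp add: algebra_simps)
qed

lemma second_tail_eq_nn_integral:
  assumes "2 \<le> n" "0 \<le> u" "u \<le> 1"
  shows "(\<integral>\<^sup>+s. ennreal (second_density n s) * indicator {0..u} s \<partial>lborel) = ennreal (second_tail n u)"
proof -
  have "(\<integral>\<^sup>+s. ennreal (second_density n s) * indicator {0..u} s \<partial>lborel)
      = ennreal (second_tail n u - second_tail n 0)"
    using assms by (intro nn_integral_FTC_Icc second_tail_deriv second_density_nonneg) auto
  then show ?thesis by (simp add: second_tail_def)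
qed

text \<open>The integral is \<open>Beta (2 - l) (n - 1)\<close> times \<open>n * (n - 1)\<close>,
  and this factor completes \<open>Gamma (n - 1)\<close> to \<open>n!\<close>.\<close>

lemma second_density_moment:
  assumes "2 \<le> n" "l < 2"
  shows "((\<lambda>s. second_density n s * s powr (- l)) has_integral beta_const n l) {0..1}"
proof -
  obtain m where n: "n = Suc (Suc m)"
    using assms(1) by (metis add_2_eq_Suc le_Suc_ex)
  \<comment> \<open>The open interval avoids the endpoints, where real and natural powers differ:
    for \<open>n = 2\<close> and \<open>s = 1\<close>, \<open>0 powr 0 = 0\<close> but
    \<open>0 ^ 0 = 1\<close>.\<close>
  have "((\<lambda>s. s powr (2 - l - 1) * (1 - s) powr (real n - 1 - 1)) has_integral
      Beta (2 - l) (real n - 1)) {0<..<1}"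
    using assms has_integral_Beta_real[of "2 - l" "real n - 1"]
    by (simp add: has_integral_Icc_iff_Ioo)
  then have "((\<lambda>s. real n * (real n - 1) * (s powr (2 - l - 1) * (1 - s) powr (real n - 1 - 1)))
      has_integral real n * (real n - 1) * Beta (2 - l) (real n - 1)) {0<..<1}"
    by (rule has_integral_mult_right)
  moreover have "real n * (real n - 1) * Beta (2 - l) (real n - 1) = beta_const n l"
  proof -
    have "Gamma (real n - 1) = fact m"
      using Gamma_fact[of m, where 'a = real] by (simp add: n add.commute)
    moreover have "2 - l + (real n - 1) = real n + 1 - l" by simp
    ultimately show ?thesis
      by (simp add: Beta_def beta_const_def n algebra_simps)
  qed
  moreover have "real n * (real n - 1) * (s powr (2 - l - 1) * (1 - s) powr (real n - 1 - 1))
      = second_density n s * s powr (- l)" if "s \<in> {0<..<1}" for s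
  proof -
    have "(1 - s) powr (real n - 1 - 1) = (1 - s) ^ m"
      using that by (simp add: n powr_realpow)
    moreover have "s powr (2 - l - 1) = s * s powr (- l)"
      using that powr_add[of s 1 "- l"] by simp
    ultimately show ?thesis by (simp add: second_density_def n)
  qed
  ultimately have "((\<lambda>s. second_density n s * s powr (- l)) has_integral beta_const n l) {0<..<1}"
    using has_integral_cong by (metis (mono_tags, lifting))
  then show ?thesis by (simp add: has_integral_Icc_iff_Ioo)
qed

lemma beta_const_pos: "2 \<le> n \<Longrightarrow> l < 2 \<Longrightarrow> 0 < beta_const n l"
  by (simp add: beta_const_def Gamma_real_pos)

text \<open>By \<open>second_density_moment\<close>, this is the total mass of
  \<open>second_density n\<close>.\<close>

lemma beta_const_0: "beta_const n 0 = 1"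
  using Gamma_fact[of n, where 'a = real] Gamma_fact[of 1, where 'a = real]
  by (simp add: beta_const_def add.commute)

text \<open>The price accepted with probability \<open>q\<close>, that is, the inverse of the tail.
  At \<open>q = 0\<close> division by zero makes it \<open>1 - r\<close>.\<close>

definition pareto_quantile :: "real \<Rightarrow> real \<Rightarrow> real \<Rightarrow> real" where
  "pareto_quantile l r q = 1 + r * (1 / q powr l - 1)"

lemma pareto_quantile_ge_1:
  assumes "0 \<le> r" "0 < l" "0 < q" "q \<le> 1"
  shows "1 \<le> pareto_quantile l r q"
proof -
  have "q powr l \<le> 1" using assms by (intro powr_le1) auto
  then show ?thesis using assms by (simp add: pareto_quantile_def)
qed

text \<open>Needed for the exchange of integrals: for fixed \<open>q\<close>, the nonnegative
  \<open>x\<close> whose tail probability is at least \<open>q\<close> form the interval from 0 to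
  the quantile.\<close>

lemma le_pareto_tail_iff:
  assumes "0 < r" "0 < l" "0 < q" "q \<le> 1"
  shows "q \<le> 1 - pareto_cdf l r x \<longleftrightarrow> x \<le> pareto_quantile l r q"
proof -
  define y where "y = 1 + (max 1 x - 1) / r"
  have y: "0 < y"
    using assms unfolding y_def by (intro add_pos_nonneg divide_nonneg_nonneg) auto
  have "q \<le> y powr (-1 / l) \<longleftrightarrow> y \<le> q powr (- l)"
  proof
    assume "q \<le> y powr (-1 / l)"
    then have "(y powr (-1 / l)) powr (- l) \<le> q powr (- l)"
      using assms by (intro powr_mono2') auto
    then show "y \<le> q powr (- l)" using assms y by (simp add: powr_powr)
  next
    assume "y \<le> q powr (- l)"
    then have "(q powr (- l)) powr (-1 / l) \<le> y powr (-1 / l)"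
      using assms y by (intro powr_mono2') auto
    then show "q \<le> y powr (-1 / l)" using assms by (simp add: powr_powr)
  qed
  also have "\<dots> \<longleftrightarrow> max 1 x \<le> pareto_quantile l r q"
  proof -
    have "1 + (a - 1) / r \<le> c \<longleftrightarrow> a \<le> 1 + r * (c - 1)" for a c
      using assms by (simp add: field_simps)
    then show ?thesis by (simp add: y_def pareto_quantile_def powr_minus_divide)
  qed
  \<comment> \<open>The clipping at 1 drops out because the quantile is at least 1.\<close>
  also have "\<dots> \<longleftrightarrow> x \<le> pareto_quantile l r q"
    using pareto_quantile_ge_1[of r l q] assms by auto
  finally show ?thesis using assms by (simp add: pareto_cdf_eq y_def)
qed

lemma pareto_quantile_cdf:
  assumes "0 < r" "0 < l" "1 \<le> x"
  shows "pareto_quantile l r (1 - pareto_cdf l r x) = x"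
proof -
  have "0 < 1 + (x - 1) / r"
    using assms by (intro add_pos_nonneg divide_nonneg_nonneg) auto
  then have "(1 + (x - 1) / r) powr (-1) = 1 / (1 + (x - 1) / r)"
    by (simp add: powr_minus_divide)
  moreover have "1 - pareto_cdf l r x = (1 + (x - 1) / r) powr (-1 / l)"
    using assms by (simp add: pareto_cdf_eq)
  then have "(1 - pareto_cdf l r x) powr l = (1 + (x - 1) / r) powr (-1 / l * l)"
    by (simp only: powr_powr)
  ultimately show ?thesis
    using assms by (simp add: pareto_quantile_def)
qed

lemma pareto_tail_range:
  assumes "0 < r" "0 < l"
  shows "0 < 1 - pareto_cdf l r x" "1 - pareto_cdf l r x \<le> 1"
proof -
  have "0 < 1 + (max 1 x - 1) / r"
    using assms by (intro add_pos_nonneg divide_nonneg_nonneg) auto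
  then show "0 < 1 - pareto_cdf l r x" using assms by (simp add: pareto_cdf_eq)
  show "1 - pareto_cdf l r x \<le> 1"
  proof -
    \<comment> \<open>A point below both \<open>x\<close> and 1: the cdf vanishes there, and
      monotonicity makes it nonnegative at \<open>x\<close>.\<close>
    have "pareto_cdf l r (min 0 x) = 0" by (simp add: pareto_cdf_def)
    then show ?thesis using pareto_cdf_mono[OF assms, of "min 0 x" x] by simp
  qed
qed

lemma borel_measurable_pareto_cdf [measurable]: "pareto_cdf l r \<in> borel_measurable borel"
  unfolding pareto_cdf_def[abs_def] by measurable

lemma nn_integral_second_tail_pareto:
  assumes "2 \<le> n" "0 < r" "0 < l"
  shows "(\<integral>\<^sup>+x. ennreal (second_tail n (1 - pareto_cdf l r x)) * indicator {0..} x \<partial>lborel)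
    = (\<integral>\<^sup>+s. ennreal (second_density n s * pareto_quantile l r s) * indicator {0..1} s \<partial>lborel)"
proof -
  let ?P = "\<lambda>x s. 0 \<le> x \<and> 0 \<le> s \<and> s \<le> 1 - pareto_cdf l r x"
  have "(\<integral>\<^sup>+x. ennreal (second_tail n (1 - pareto_cdf l r x)) * indicator {0..} x \<partial>lborel)
      = (\<integral>\<^sup>+x. (\<integral>\<^sup>+s. (if ?P x s then ennreal (second_density n s) else 0) \<partial>lborel) \<partial>lborel)"
  proof (intro nn_integral_cong)
    fix x :: real
    show "ennreal (second_tail n (1 - pareto_cdf l r x)) * indicator {0..} x
        = (\<integral>\<^sup>+s. (if ?P x s then ennreal (second_density n s) else 0) \<partial>lborel)"
    proof (cases "0 \<le> x")
      case True
      have "ennreal (second_tail n (1 - pareto_cdf l r x))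
          = (\<integral>\<^sup>+s. ennreal (second_density n s) * indicator {0..1 - pareto_cdf l r x} s \<partial>lborel)"
        using assms pareto_tail_range[of r l x]
        by (intro second_tail_eq_nn_integral[symmetric]) auto
      also have "\<dots> = (\<integral>\<^sup>+s. (if ?P x s then ennreal (second_density n s) else 0) \<partial>lborel)"
        using True by (intro nn_integral_cong) (auto simp: indicator_def)
      finally show ?thesis using True by simp
    qed simp
  qed
  also have "\<dots> = (\<integral>\<^sup>+s. (\<integral>\<^sup>+x. (if ?P x s then ennreal (second_density n s) else 0) \<partial>lborel) \<partial>lborel)"
    by (rule lborel_pair.Fubini'[symmetric]) measurable
  also have "\<dots> = (\<integral>\<^sup>+s. ennreal (second_density n s * pareto_quantile l r s) * indicator {0..1} s \<partial>lborel)"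
  proof (intro nn_integral_cong)
    fix s :: real
    consider "s < 0 \<or> 1 < s" | "s = 0" | "0 < s" "s \<le> 1" by linarith
    then show "(\<integral>\<^sup>+x. (if ?P x s then ennreal (second_density n s) else 0) \<partial>lborel)
        = ennreal (second_density n s * pareto_quantile l r s) * indicator {0..1} s"
    proof cases
      case 1
      then have none: "\<not> ?P x s" for x using pareto_tail_range(2)[of r l x] assms by linarith
      have "(\<integral>\<^sup>+x. (if ?P x s then ennreal (second_density n s) else 0) \<partial>lborel) = 0"
        by (simp only: none if_False) simp
      with 1 show ?thesis by auto
    next
      case 2
      \<comment> \<open>Here the slice in \<open>x\<close> is the whole half-line, of infinite
        length, but the density factor is 0.\<close>
      then have "second_density n s = 0" by (simp add: second_density_def)
      then show ?thesis by (simp cong: if_cong)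
    next
      case 3
      have "(\<integral>\<^sup>+x. (if ?P x s then ennreal (second_density n s) else 0) \<partial>lborel)
          = (\<integral>\<^sup>+x. ennreal (second_density n s) * indicator {0..pareto_quantile l r s} x \<partial>lborel)"
        using 3 assms le_pareto_tail_iff[of r l s]
        by (intro nn_integral_cong) (auto simp: indicator_def)
      also have "\<dots> = ennreal (second_density n s) * ennreal (pareto_quantile l r s)"
        using pareto_quantile_ge_1[of r l s] 3 assms by (simp add: nn_integral_cmult)
      finally show ?thesis
        using 3 assms second_density_nonneg[of n s] by (simp add: ennreal_mult')
    qed
  qed
  finally show ?thesis .
qed

lemma spa_revenue_pareto:
  assumes "2 \<le> n" "0 < r" "r \<le> 1" "0 < l" "l \<le> 1"
  shows "has_bochner_integral (valuations (pareto_cdf l r) n) (\<lambda>v. \<Sum>i<n. spa_pay n i v)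
    (1 + r * (beta_const n l - 1))"
proof -
  \<comment> \<open>The quantile is \<open>(1 - r) + r * s powr (- l)\<close>, so the integral
    combines the moments of orders 0 and \<open>l\<close>. The exponent \<open>- 0\<close> matches
    the shape of \<open>second_density_moment\<close>.\<close>
  have "((\<lambda>s. (1 - r) * (second_density n s * s powr (- 0)) + r * (second_density n s * s powr (- l)))
      has_integral (1 - r) * beta_const n 0 + r * beta_const n l) {0<..<1}"
    using assms second_density_moment[of n 0] second_density_moment[of n l]
    by (intro has_integral_add has_integral_mult_right) (auto simp: has_integral_Icc_iff_Ioo)
  moreover have "(1 - r) * beta_const n 0 + r * beta_const n l = 1 + r * (beta_const n l - 1)"
    by (simp add: beta_const_0 algebra_simps)
  moreover have "(1 - r) * (second_density n s * s powr (- 0)) + r * (second_density n s * s powr (- l))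
      = second_density n s * pareto_quantile l r s" if "s \<in> {0<..<1}" for s
    using that by (simp add: pareto_quantile_def powr_minus_divide algebra_simps)
  ultimately have "((\<lambda>s. second_density n s * pareto_quantile l r s) has_integral
      1 + r * (beta_const n l - 1)) {0<..<1}"
    using has_integral_cong by (metis (mono_tags, lifting))
  then have int: "((\<lambda>s. second_density n s * pareto_quantile l r s) has_integral
      1 + r * (beta_const n l - 1)) {0..1}"
    by (simp add: has_integral_Icc_iff_Ioo)
  \<comment> \<open>The quantile bound covers only positive \<open>s\<close>; at 0 the density
    vanishes.\<close>
  have nonneg: "0 \<le> second_density n s * pareto_quantile l r s" if "s \<in> {0..1}" for s
    using that assms pareto_quantile_ge_1[of r l s] second_density_nonneg[of n s]
    by (cases "s = 0") (auto simp: second_density_def)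
  have "(\<integral>\<^sup>+v. ennreal (\<Sum>i<n. spa_pay n i v) \<partial>valuations (pareto_cdf l r) n)
      = ennreal (1 + r * (beta_const n l - 1))"
    using assms nn_integral_has_integral_lebesgue'[OF nonneg int]
    by (simp add: nn_integral_spa_revenue real_distribution_pareto cdf_pareto
        nn_integral_second_tail_pareto)
  moreover have "0 \<le> 1 + r * (beta_const n l - 1)"
    using has_integral_nonneg[OF int nonneg] .
  ultimately show ?thesis
    by (intro has_bochner_integral_nn_integral)
      (auto intro!: AE_I2 sum_nonneg simp: spa_pay_def threshold_nonneg)
qed

lemma myerson_pareto_ge:
  assumes "2 \<le> n" "0 < r" "r \<le> 1" "0 < l" "l \<le> 1"
  shows "ereal (1 + r * (beta_const n l - 1)) \<le> myerson (pareto_cdf l r) n"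
proof -
  have "truthful_auction (pareto_cdf l r) n (spa_alloc n) (spa_pay n)"
    using assms by (intro truthful_spa) (auto simp: val_support_pareto)
  then show ?thesis
    using spa_revenue_pareto[OF assms] unfolding myerson_def has_bochner_integral_iff
    by (intro Sup_upper CollectI exI[of _ "spa_alloc n"] exI[of _ "spa_pay n"]) auto
qed

section \<open>The approximation ratio\<close>

lemma H_raw_pareto_quantile:
  "H_raw n l r q = pareto_quantile l r q * (1 - (1 - q) ^ n)"
  by (simp add: H_raw_def pareto_quantile_def)

text \<open>The factor \<open>q\<close> of \<open>1 - (1 - q) ^ n\<close> absorbs the singularity
  \<open>1 / q powr l\<close>. The remaining \<open>q powr (1 - l)\<close> is bounded by 1, which
  gives both the limit at 0 and a uniform bound.\<close>

lemma H_raw_eq_sum: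
  assumes "0 < q"
  shows "H_raw n l r q = (1 - r) * (1 - (1 - q) ^ n) + r * q powr (1 - l) * (\<Sum>k<n. (1 - q) ^ k)"
proof -
  have geo: "1 - (1 - q) ^ n = q * (\<Sum>k<n. (1 - q) ^ k)"
    using one_diff_power_eq[of "1 - q" n] by simp
  have "q powr (1 - l) = q / q powr l"
    using assms by (simp add: powr_diff)
  moreover have "H_raw n l r q = (1 - r) * (1 - (1 - q) ^ n) + r / q powr l * (1 - (1 - q) ^ n)"
    by (simp add: H_raw_def algebra_simps)
  ultimately show ?thesis by (simp add: geo)
qed

text \<open>In the form of \<open>H_raw_eq_sum\<close>, the power \<open>q powr (1 - l)\<close> is
  constantly 1 if \<open>l = 1\<close> and tends to 0 otherwise, while the geometric sum tends to
  \<open>n\<close>.\<close>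

lemma H_raw_tendsto:
  assumes "0 < l" "l \<le> 1"
  shows "(H_raw n l r \<longlongrightarrow> (if l = 1 then r * real n else 0)) (at_right 0)"
proof -
  have "((\<lambda>q. q powr (1 - l)) \<longlongrightarrow> (if l = 1 then 1 else 0)) (at_right 0)"
  proof (cases "l = 1")
    case True
    have "\<forall>\<^sub>F q in at_right 0. q powr (1 - l) = (1 :: real)"
      using eventually_at_right_less[of "0 :: real"] by eventually_elim (simp add: True)
    with True show ?thesis by (simp add: tendsto_eventually)
  next
    case False
    with assms have "0 < 1 - l" by simp
    then have "((\<lambda>q. q powr (1 - l)) \<longlongrightarrow> 0) (at_right 0)" by real_asymp
    with False show ?thesis by simp
  qed
  then have "((\<lambda>q. (1 - r) * (1 - (1 - q) ^ n) + r * q powr (1 - l) * (\<Sum>k<n. (1 - q) ^ k))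
      \<longlongrightarrow> (1 - r) * (1 - (1 - 0) ^ n) + r * (if l = 1 then 1 else 0) * (\<Sum>k<n. (1 - 0) ^ k))
      (at_right 0)"
    by (intro tendsto_intros)
  moreover have "\<forall>\<^sub>F q in at_right 0.
      (1 - r) * (1 - (1 - q) ^ n) + r * q powr (1 - l) * (\<Sum>k<n. (1 - q) ^ k) = H_raw n l r q"
    using eventually_at_right_less[of "0 :: real"] by eventually_elim (simp add: H_raw_eq_sum)
  ultimately have "(H_raw n l r \<longlongrightarrow>
      (1 - r) * (1 - (1 - 0) ^ n) + r * (if l = 1 then 1 else 0) * (\<Sum>k<n. (1 - 0) ^ k)) (at_right 0)"
    by (rule Lim_transform_eventually)
  then show ?thesis by (simp split: if_splits)
qed

lemma H_fun_0:
  assumes "0 < l" "l \<le> 1"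
  shows "H_fun n l r 0 = (if l = 1 then r * real n else 0)"
  using tendsto_Lim[OF _ H_raw_tendsto[OF assms, of n r]] by (simp add: H_fun_def)

text \<open>The upper bound is crude, but it makes the supremum over \<open>q\<close> finite and
  tends to 1 as \<open>r\<close> tends to 0.\<close>

lemma H_fun_bounds:
  assumes "0 < l" "l \<le> 1" "0 \<le> r" "r \<le> 1" "0 \<le> q" "q \<le> 1"
  shows "0 \<le> H_fun n l r q" "H_fun n l r q \<le> 1 + r * real n"
proof -
  have "0 \<le> H_fun n l r q \<and> H_fun n l r q \<le> 1 + r * real n"
  proof (cases "q = 0")
    case True
    with assms show ?thesis by (simp add: H_fun_0)
  next
    case False
    define a where "a = 1 - (1 - q) ^ n"
    define b where "b = q powr (1 - l)"
    define c where "c = (\<Sum>k<n. (1 - q) ^ k)"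
    have a: "0 \<le> a" "a \<le> 1"
      using assms by (auto simp: a_def power_le_one)
    have b: "0 \<le> b" "b \<le> 1"
      using assms by (auto simp: b_def powr_le1)
    have c: "0 \<le> c" "c \<le> real n"
      using assms sum_bounded_above[of "{..<n}" "\<lambda>k. (1 - q) ^ k" 1]
      by (auto simp: c_def power_le_one intro!: sum_nonneg)
    have "H_fun n l r q = (1 - r) * a + r * b * c"
      using False assms by (simp add: H_fun_def H_raw_eq_sum a_def b_def c_def)
    moreover have "(1 - r) * a \<le> 1 * 1"
      using assms a by (intro mult_mono) auto
    moreover have "r * (b * c) \<le> r * (1 * real n)"
      using assms b c by (intro mult_left_mono mult_mono) auto
    ultimately show ?thesis
      using assms a b c by (simp add: mult.assoc)
  qed
  then show "0 \<le> H_fun n l r q" "H_fun n l r q \<le> 1 + r * real n" by auto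
qed

lemma H_fun_1: "0 < n \<Longrightarrow> H_fun n l r 1 = 1"
  by (simp add: H_fun_def H_raw_def)

section \<open>Anonymous pricing and the ratio for the Pareto distribution\<close>

lemma price_pareto_le:
  assumes "0 < r" "0 < l"
  shows "price (pareto_cdf l r) n \<le> (SUP q\<in>{0..1}. ereal (H_fun n l r q))"
  unfolding price_def
proof (rule SUP_least)
  fix p assume "p \<in> val_support (pareto_cdf l r)"
  then have p: "1 \<le> p" using assms by (simp add: val_support_pareto)
  \<comment> \<open>The probability that a single bidder accepts \<open>p\<close>. It is positive,
    so \<open>H_fun\<close> and \<open>H_raw\<close> agree there.\<close>
  let ?q = "1 - pareto_cdf l r p"
  have "p * (1 - pareto_cdf l r p ^ n) = H_raw n l r ?q"
    using assms p by (simp add: H_raw_pareto_quantile pareto_quantile_cdf)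
  also have "\<dots> = H_fun n l r ?q"
    using pareto_tail_range[of r l p] assms by (simp add: H_fun_def)
  finally show "ereal (p * (1 - pareto_cdf l r p ^ n)) \<le> (SUP q\<in>{0..1}. ereal (H_fun n l r q))"
    using pareto_tail_range[of r l p] assms by (auto intro!: SUP_upper2[of ?q])
qed

text \<open>The price 1 is always accepted, since the cdf vanishes at 1. This keeps the denominator
  of the ratio positive.\<close>

lemma price_pareto_ge_1:
  assumes "0 < r" "0 < l" "0 < n"
  shows "1 \<le> price (pareto_cdf l r) n"
  unfolding price_def
  by (rule SUP_upper2[of 1]) (use assms in \<open>auto simp: val_support_pareto pareto_cdf_def power_0_left\<close>)

lemma apx_numerator_pos:
  assumes "2 \<le> n" "l \<le> 1" "0 \<le> r" "r \<le> 1"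
  shows "0 < 1 + r * (beta_const n l - 1)"
proof -
  have "1 + r * (beta_const n l - 1) = (1 - r) + r * beta_const n l"
    by (simp add: algebra_simps)
  moreover have "0 < (1 - r) + r * beta_const n l"
    using assms beta_const_pos[of n l]
    by (cases "r = 0") (auto intro!: add_nonneg_pos)
  ultimately show ?thesis by simp
qed

lemma apx_pareto_ge:
  assumes "2 \<le> n" "0 < r" "r \<le> 1" "0 < l" "l \<le> 1"
  shows "ereal (1 + r * (beta_const n l - 1)) / (SUP q\<in>{0..1}. ereal (H_fun n l r q))
    \<le> apx (pareto_cdf l r) n"
proof -
  have pos: "0 < price (pareto_cdf l r) n"
    using price_pareto_ge_1[of r l n] assms by (auto intro: less_le_trans[of 0 1])
  have le: "price (pareto_cdf l r) n \<le> (SUP q\<in>{0..1}. ereal (H_fun n l r q))"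
    using assms by (intro price_pareto_le)
  have "ereal (1 + r * (beta_const n l - 1)) / (SUP q\<in>{0..1}. ereal (H_fun n l r q))
      \<le> ereal (1 + r * (beta_const n l - 1)) / price (pareto_cdf l r) n"
    using le pos apx_numerator_pos[of n l r] assms
    by (intro ereal_divide_left_mono) (auto simp: ereal_zero_less_0_iff)
  also have "\<dots> \<le> apx (pareto_cdf l r) n"
    unfolding apx_def using assms pos by (intro ereal_divide_right_mono myerson_pareto_ge)
  finally show ?thesis .
qed

lemma SUP_H_fun:
  assumes "0 < n" "0 < l" "l \<le> 1" "0 \<le> r" "r \<le> 1"
  obtains s where "(SUP q\<in>{0..1}. ereal (H_fun n l r q)) = ereal s" "1 \<le> s" "s \<le> 1 + r * real n"
    "\<And>q. q \<in> {0..1} \<Longrightarrow> H_fun n l r q \<le> s"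
proof -
  let ?S = "SUP q\<in>{0..1}. ereal (H_fun n l r q)"
  have ge: "1 \<le> ?S"
    by (rule SUP_upper2[of 1]) (use assms in \<open>auto simp: H_fun_1\<close>)
  have le: "?S \<le> ereal (1 + r * real n)"
    using assms H_fun_bounds(2) by (intro SUP_least) auto
  obtain s where s: "?S = ereal s"
    using ge le by (cases ?S) auto
  moreover have "H_fun n l r q \<le> s" if "q \<in> {0..1}" for q
    using SUP_upper[OF that, of "\<lambda>q. ereal (H_fun n l r q)"] s by simp
  ultimately show ?thesis
    using ge le that by (simp add: one_ereal_def)
qed

text \<open>If the infimum exceeded \<open>N / s\<close>, a real \<open>c\<close> strictly between
  them would force \<open>h q <= N / c\<close> for all \<open>q\<close>, zeros of \<open>h\<close>
  included. Then the supremum would be at most \<open>N / c\<close>, which is less than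
  \<open>s\<close>.\<close>

lemma INF_quotient_le:
  fixes h :: "'a \<Rightarrow> real"
  assumes "0 < N" "0 < s" "\<And>q. q \<in> A \<Longrightarrow> 0 \<le> h q" "(SUP q\<in>A. ereal (h q)) = ereal s"
  shows "(INF q\<in>A. if h q = 0 then \<infinity> else ereal (N / h q)) \<le> ereal (N / s)"
proof (rule ccontr)
  let ?I = "INF q\<in>A. if h q = 0 then \<infinity> else ereal (N / h q)"
  assume "\<not> ?I \<le> ereal (N / s)"
  then have "ereal (N / s) < ?I" by (simp only: not_le)
  from ereal_dense2[OF this] obtain c where "ereal (N / s) < ereal c" and c2: "ereal c < ?I"
    by blast
  then have c: "N / s < c" by simp
  have "0 < N / s" using assms by simp
  then have "0 < c" using c by linarith
  have "h q \<le> N / c" if "q \<in> A" for q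
  proof (cases "h q = 0")
    case False
    then have "ereal c < ereal (N / h q)"
      using less_le_trans[OF c2 INF_lower[OF that]] by simp
    then show ?thesis
      using False assms(3)[OF that] \<open>0 < c\<close> by (simp add: field_simps)
  qed (use \<open>0 < c\<close> assms in auto)
  then have "(SUP q\<in>A. ereal (h q)) \<le> ereal (N / c)"
    by (intro SUP_least) auto
  then have "s \<le> N / c" using assms by simp
  then show False using c \<open>0 < c\<close> assms by (simp add: field_simps)
qed

section \<open>Worst case over the regular family\<close>

lemma apx_worst_ge_pareto:
  assumes "2 \<le> n" "0 < r" "r \<le> 1" "0 < l" "l \<le> 1"
  shows "ereal (1 + r * (beta_const n l - 1)) / (SUP q\<in>{0..1}. ereal (H_fun n l r q)) \<le> apx_worst n l"
  using apx_pareto_ge[OF assms] pareto_regular[of r l] assms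
  unfolding apx_worst_def by (auto intro: SUP_upper2)

text \<open>At \<open>r = 0\<close> the formula for the cdf degenerates to the constant 0, so the
  bound is a limit over small positive \<open>r\<close>. Dropping the nonnegative term
  \<open>r * beta_const n l\<close> and using the crude bound on \<open>H_fun\<close> leaves
  \<open>(1 - r) / (1 + r * n)\<close>, which tends to 1.\<close>

lemma apx_worst_ge_1:
  assumes "2 \<le> n" "0 < l" "l \<le> 1"
  shows "1 \<le> apx_worst n l"
proof (rule tendsto_upperbound)
  show "((\<lambda>r. ereal ((1 - r) / (1 + r * real n))) \<longlongrightarrow> 1) (at_right 0)"
  proof -
    have "((\<lambda>r. (1 - r) / (1 + r * real n)) \<longlongrightarrow> (1 - 0) / (1 + 0 * real n)) (at_right 0)"
      by (intro tendsto_intros) auto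
    then show ?thesis by (simp add: one_ereal_def)
  qed
  show "\<forall>\<^sub>F r in at_right 0. ereal ((1 - r) / (1 + r * real n)) \<le> apx_worst n l"
    using eventually_at_right_real[of 0 "1 :: real", OF zero_less_one]
  proof eventually_elim
    case (elim r)
    then have r: "0 < r" "r \<le> 1" by auto
    obtain s where s: "(SUP q\<in>{0..1}. ereal (H_fun n l r q)) = ereal s" "1 \<le> s" "s \<le> 1 + r * real n"
      using SUP_H_fun[of n l r] assms r by auto
    have "0 \<le> r * beta_const n l" using r assms beta_const_pos[of n l] by simp
    then have "1 - r \<le> 1 + r * (beta_const n l - 1)" by (simp add: algebra_simps)
    then have "(1 - r) / (1 + r * real n) \<le> (1 + r * (beta_const n l - 1)) / s"
      using s r by (intro frac_le) auto
    then have "ereal ((1 - r) / (1 + r * real n)) \<le> ereal ((1 + r * (beta_const n l - 1)) / s)"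
      by simp
    also have "\<dots> \<le> apx_worst n l"
      using apx_worst_ge_pareto[of n r l] assms r s by auto
    finally show ?case .
  qed
qed simp

theorem theorem5p3:
  fixes n :: nat and l :: real
  assumes "n \<ge> 2" and "0 < l" and "l \<le> 1"
  shows "(\<forall>r\<in>{0<..1}. apx (pareto_cdf l r) n \<ge>
            ereal (1 + r * (beta_const n l - 1)) / (SUP q\<in>{0..1}. ereal (H_fun n l r q))) \<and>
         apx_worst n l \<ge>
           (SUP r\<in>{0..1}. INF q\<in>{0..1}.
              if H_fun n l r q = 0 then \<infinity>
              else ereal ((1 + r * (beta_const n l - 1)) / H_fun n l r q))"
proof (intro conjI ballI SUP_least)
  fix r :: real assume "r \<in> {0<..1}"
  then show "ereal (1 + r * (beta_const n l - 1)) / (SUP q\<in>{0..1}. ereal (H_fun n l r q))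
      \<le> apx (pareto_cdf l r) n"
    using assms by (intro apx_pareto_ge) auto
next
  fix r :: real assume r: "r \<in> {0..1}"
  let ?I = "INF q\<in>{0..1}. if H_fun n l r q = 0 then \<infinity>
      else ereal ((1 + r * (beta_const n l - 1)) / H_fun n l r q)"
  show "?I \<le> apx_worst n l"
  proof (cases "r = 0")
    case True
    \<comment> \<open>For \<open>r = 0\<close> the numerator is 1, and \<open>H_fun\<close> is 1 at
      \<open>q = 1\<close>.\<close>
    have "?I \<le> 1"
      by (rule INF_lower2[of 1]) (use assms True in \<open>auto simp: H_fun_1\<close>)
    also have "\<dots> \<le> apx_worst n l" using assms by (intro apx_worst_ge_1)
    finally show ?thesis .
  next
    case False
    obtain s where s: "(SUP q\<in>{0..1}. ereal (H_fun n l r q)) = ereal s" "1 \<le> s"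
      using SUP_H_fun[of n l r] assms r by auto
    have "?I \<le> ereal ((1 + r * (beta_const n l - 1)) / s)"
      using s assms r apx_numerator_pos[of n l r] H_fun_bounds(1)[of l r]
      by (intro INF_quotient_le) auto
    also have "\<dots> \<le> apx_worst n l"
      using apx_worst_ge_pareto[of n r l] assms r s False by auto
    finally show ?thesis .
  qed
qed

end
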